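(* Let $\pi_{\mathrm p}\in(0,1)$, let $\mathbb{P}_{\mathrm p}$ and $\mathbb{P}_{\mathrm n}$ be the class-conditional distributions of positive and negative nodes, i.e. of the observation $(\boldsymbol{x},\mathcal{G}_{\boldsymbol{x}}^{\boldsymbol{A}})$ given $y=+1$ and $y=-1$ respectively, and let $\mathbb{P}=\pi_{\mathrm p}\mathbb{P}_{\mathrm p}+(1-\pi_{\mathrm p})\mathbb{P}_{\mathrm n}$ be the marginal distribution of the observation. Then $\mathbb{P}_{\mathrm n}$ is irreducible with respect to $\mathbb{P}_{\mathrm p}$ if and only if $$\operatorname*{ess\,sup}_{i\in\mathcal{V}}\ \mathbb{P}\big(y=+1\mid \boldsymbol{x}_i,\mathcal{G}_{\boldsymbol{x}_i}^{\boldsymbol{A}}\big)=1 .$$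
   Context: Setting: $\mathcal{V}$ is the node set of an undirected graph with adjacency matrix $\boldsymbol{A}$. Each node $i$ has a feature vector $\boldsymbol{x}_i\in\mathbb{R}^D$ and a latent label $y_i\in\{-1,+1\}$. $\mathcal{G}_{\boldsymbol{x}}^{\boldsymbol{A}}$ denotes the ego-graph centered at the node with features $\boldsymbol{x}$: the features of its neighboring nodes (within a certain number of hops) together with the associated adjacency matrix. The pair $(\boldsymbol{x},\mathcal{G}_{\boldsymbol{x}}^{\boldsymbol{A}})$ is regarded as a random observation in a measurable space. The class-conditional distributions $\mathbb{P}_{\mathrm p},\mathbb{P}_{\mathrm n}$ have densities $\mathbb{P}(\boldsymbol{x},\mathcal{G}_{\boldsymbol{x}}^{\boldsymbol{A}}\mid y=+1)$ and $\mathbb{P}(\boldsymbol{x},\mathcal{G}_{\boldsymbol{x}}^{\boldsymbol{A}}\mid y=-1)$ with respect to a common dominating measure, and the marginal has density $$\mathbb{P}(\boldsymbol{x},\mathcal{G}_{\boldsymbol{x}}^{\boldsymbol{A}})=\pi_{\mathrm p}\,\mathbb{P}(\boldsymbol{x},\mathcal{G}_{\boldsymbol{x}}^{\boldsymbol{A}}\mid y=+1)+(1-\pi_{\mathrm p})\,\mathbb{P}(\boldsymbol{x},\mathcal{G}_{\boldsymbol{x}}^{\boldsymbol{A}}\mid y=-1).$$ Irreducibility: $\mathbb{P}_{\mathrm n}$ is irreducible with respect to $\mathbb{P}_{\mathrm p}$ if there is no decomposition $\mathbb{P}_{\mathrm n}=(1-\beta)Q+\beta\,\mathbb{P}_{\mathrm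 p}$ with $Q$ a probability distribution and $0<\beta\le 1$. Posterior (latent label model): $$\mathbb{P}(y=+1\mid \boldsymbol{x},\mathcal{G}_{\boldsymbol{x}}^{\boldsymbol{A}})=\begin{cases}\dfrac{\pi_{\mathrm p}\,\mathbb{P}(\boldsymbol{x},\mathcal{G}_{\boldsymbol{x}}^{\boldsymbol{A}}\mid y=+1)}{\mathbb{P}(\boldsymbol{x},\mathcal{G}_{\boldsymbol{x}}^{\boldsymbol{A}})}, & \mathbb{P}(\boldsymbol{x},\mathcal{G}_{\boldsymbol{x}}^{\boldsymbol{A}})>0,\\ 0,&\text{otherwise.}\end{cases}$$ The subscript $i\in\mathcal{V}$ in $\operatorname{ess\,sup}$ means that the essential supremum is taken over the observations $(\boldsymbol{x}_i,\mathcal{G}_{\boldsymbol{x}_i}^{\boldsymbol{A}})$, with respect to the marginal distribution $\mathbb{P}$. *)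

theory Defs
  imports "HOL-Probability.Probability" "HOL-Probability.Essential_Supremum"
begin

definition mixture :: "real \<Rightarrow> 'o measure \<Rightarrow> 'o measure \<Rightarrow> 'o measure" where
  "mixture c P Q = measure_of (space P) (sets P)
     (\<lambda>A. ennreal c * emeasure P A + ennreal (1 - c) * emeasure Q A)"

lemma space_mixture: "space (mixture c P Q) = space P"
  by (simp add: mixture_def space_measure_of_conv)

lemma sets_mixture: "sets (mixture c P Q) = sets P"
  by (simp add: mixture_def sets.sigma_sets_eq sets.space_closed)

text \<open>\<^const>\<open>measure_of\<close> yields the null measure on set functions that are not measures; the next
  fact shows that this does not happen when both components live on the same measurable space.\<close>

lemma emeasure_mixture:
  assumes "sets P = sets Q" "A \<in> sets P"
  shows "emeasure (mixture c P Q) A =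
    ennreal c * emeasure P A + ennreal (1 - c) * emeasure Q A"
proof (rule emeasure_measure_of[OF mixture_def])
  show "sets P \<subseteq> Pow (space P)"
    by (rule sets.space_closed)
  show "A \<in> sets (mixture c P Q)"
    using assms(2) by (simp add: sets_mixture)
  show "positive (sets (mixture c P Q))
      (\<lambda>A. ennreal c * emeasure P A + ennreal (1 - c) * emeasure Q A)"
    by (simp add: positive_def)
  show "countably_additive (sets (mixture c P Q))
      (\<lambda>A. ennreal c * emeasure P A + ennreal (1 - c) * emeasure Q A)"
  proof (rule countably_additiveI)
    fix B :: "nat \<Rightarrow> 'a set"
    assume B: "range B \<subseteq> sets (mixture c P Q)" "disjoint_family B"
    then have "(\<Sum>i. emeasure P (B i)) = emeasure P (\<Union>i. B i)"
      and "(\<Sum>i. emeasure Q (B i)) = emeasure Q (\<Union>i. B i)"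
      using assms(1) by (auto intro!: suminf_emeasure simp: sets_mixture)
    then show "(\<Sum>i. ennreal c * emeasure P (B i) + ennreal (1 - c) * emeasure Q (B i))
        = ennreal c * emeasure P (\<Union>i. B i) + ennreal (1 - c) * emeasure Q (\<Union>i. B i)"
      by (simp add: suminf_add[symmetric] ennreal_suminf_cmult)
  qed
qed

definition irreducible_wrt :: "'o measure \<Rightarrow> 'o measure \<Rightarrow> bool" where
  "irreducible_wrt Pn Pp \<longleftrightarrow>
     \<not> (\<exists>Q \<beta>. prob_space Q \<and> sets Q = sets Pp \<and> 0 < \<beta> \<and> \<beta> \<le> 1 \<and> Pn = mixture \<beta> Pp Q)"

definition marginal_density :: "real \<Rightarrow> ('o \<Rightarrow> real) \<Rightarrow> ('o \<Rightarrow> real) \<Rightarrow> 'o \<Rightarrow> real" where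
  "marginal_density \<pi>p fp fn z = \<pi>p * fp z + (1 - \<pi>p) * fn z"

text \<open>\<open>fp\<close> and \<open>fn\<close> are the class-conditional densities given \<open>y = +1\<close> and \<open>y = -1\<close>.\<close>

definition posterior :: "real \<Rightarrow> ('o \<Rightarrow> real) \<Rightarrow> ('o \<Rightarrow> real) \<Rightarrow> 'o \<Rightarrow> real" where
  "posterior \<pi>p fp fn z =
     (if marginal_density \<pi>p fp fn z > 0 then \<pi>p * fp z / marginal_density \<pi>p fp fn z else 0)"

text \<open>An observation is a pair of a feature vector and an ego-graph. The type of ego-graphs is a
  parameter, so that any encoding (neighbour features with an adjacency matrix, for any number of
  hops) is covered; the \<open>\<sigma>\<close>-algebra on observations comes with the dominating measure.\<close>

type_synonym ('d, 'g) observation = "(real ^ 'd) \<times> 'g"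

end

theory Submission imports Defs begin

text \<open>Both sides of the equivalence measure whether the likelihood ratio \<open>fn / fp\<close> is bounded away from
  zero. A decomposition with weight \<open>\<beta>\<close> forces \<open>Pn \<ge> \<beta> Pp\<close>, and conversely if
  \<open>fn \<ge> \<beta> fp\<close> almost everywhere then the normalised remainder \<open>(fn - \<beta> fp) / (1 - \<beta>)\<close> is the density
  of the other component. The posterior is a strictly decreasing function of \<open>fn / fp\<close> that tends to
  \<open>1\<close> as the ratio tends to \<open>0\<close>, so it stays below some \<open>c < 1\<close> exactly when the ratio stays above some
  \<open>\<beta> > 0\<close>.\<close>

section \<open>Mixtures of densities and irreducibility\<close>

lemma mixture_density:
  assumes [measurable]: "f \<in> borel_measurable M" "g \<in> borel_measurable M"
  shows "mixture c (density M f) (density M g) =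
    density M (\<lambda>z. ennreal c * f z + ennreal (1 - c) * g z)"
proof (rule measure_eqI)
  fix A assume "A \<in> sets (mixture c (density M f) (density M g))"
  then have [measurable]: "A \<in> sets M"
    by (simp add: sets_mixture)
  show "emeasure (mixture c (density M f) (density M g)) A =
      emeasure (density M (\<lambda>z. ennreal c * f z + ennreal (1 - c) * g z)) A"
    by (simp add: emeasure_mixture emeasure_density nn_integral_cmult nn_integral_add
        distrib_right mult.assoc)
qed (simp add: sets_mixture)

text \<open>Losing the factor \<open>2\<close> makes \<open>A\<close> below a null set by comparing two finite measures only, with no
  need for \<open>\<sigma>\<close>-finiteness of \<open>M\<close> or for the uniqueness of densities.\<close>

lemma AE_ge_of_mixture:
  fixes fp fn :: "'o \<Rightarrow> real"
  assumes [measurable]: "fp \<in> borel_measurable M" "fn \<in> borel_measurable M"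
    and fp0: "\<And>z. z \<in> space M \<Longrightarrow> 0 \<le> fp z" and fn0: "\<And>z. z \<in> space M \<Longrightarrow> 0 \<le> fn z"
    and Pp: "prob_space (density M (\<lambda>z. ennreal (fp z)))" (is "prob_space ?Pp")
    and "sets Q = sets M" and \<beta>: "0 < \<beta>"
    and mix: "density M (\<lambda>z. ennreal (fn z)) = mixture \<beta> (density M (\<lambda>z. ennreal (fp z))) Q" (is "?Pn = _")
  shows "AE z in M. \<beta> / 2 * fp z \<le> fn z"
proof -
  interpret Pp: prob_space ?Pp by fact
  define A where "A = {z \<in> space M. fn z < \<beta> / 2 * fp z}"
  have [measurable]: "A \<in> sets M"
    unfolding A_def by measurable
  \<comment> \<open>The contribution of \<open>Q\<close> to the mixture is nonnegative and is
    dropped.\<close>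
  have "ennreal \<beta> * emeasure ?Pp A \<le> emeasure ?Pn A"
    unfolding mix using assms(6) by (subst emeasure_mixture) auto
  also have "emeasure ?Pn A = (\<integral>\<^sup>+z. ennreal (fn z) * indicator A z \<partial>M)"
    by (simp add: emeasure_density)
  also have "\<dots> \<le> (\<integral>\<^sup>+z. ennreal (\<beta> / 2) * (ennreal (fp z) * indicator A z) \<partial>M)"
    using \<beta> by (intro nn_integral_mono)
      (auto simp: A_def fp0 ennreal_mult[symmetric] split: split_indicator intro!: ennreal_leI)
  also have "\<dots> = ennreal (\<beta> / 2) * emeasure ?Pp A"
    by (simp add: emeasure_density nn_integral_cmult)
  finally have "\<beta> * measure ?Pp A \<le> \<beta> / 2 * measure ?Pp A"
    using \<beta> by (simp add: Pp.emeasure_eq_measure ennreal_mult[symmetric])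
  then have "measure ?Pp A \<le> 0"
    using \<beta> by (simp add: mult_le_cancel_right)
  then have "A \<in> null_sets ?Pp"
    by (intro null_setsI) (auto simp: Pp.emeasure_eq_measure measure_le_0_iff)
  then have "AE z in ?Pp. z \<notin> A"
    by (rule AE_not_in)
  \<comment> \<open>A null set of \<open>?Pp\<close> is controlled under \<open>M\<close> only where
    \<open>fp\<close> is positive; where \<open>fp\<close> vanishes, the bound reduces to
    \<open>0 \<le> fn z\<close>.\<close>
  then have "AE z in M. 0 < fp z \<longrightarrow> z \<notin> A"
    by (simp add: AE_density)
  then show ?thesis
    using AE_space
  proof eventually_elim
    case (elim z)
    then show ?case
      using fp0[of z] fn0[of z] by (cases "fp z = 0") (auto simp: A_def)
  qed
qed

text \<open>The remainder has the right density by construction. It is a probability because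
  \<open>?Pp\<close> and \<open>?Pn\<close> both have mass one, which fixes its mass once the
  mixture is evaluated on the whole space.\<close>

lemma mixture_of_AE_ge:
  fixes fp fn :: "'o \<Rightarrow> real"
  assumes [measurable]: "fp \<in> borel_measurable M" "fn \<in> borel_measurable M"
    and fp0: "\<And>z. z \<in> space M \<Longrightarrow> 0 \<le> fp z"
    and Pp: "prob_space (density M (\<lambda>z. ennreal (fp z)))" (is "prob_space ?Pp")
    and Pn: "prob_space (density M (\<lambda>z. ennreal (fn z)))" (is "prob_space ?Pn")
    and \<beta>: "0 < \<beta>" "\<beta> < 1" and ge: "AE z in M. \<beta> * fp z \<le> fn z"
  obtains Q where "prob_space Q" "sets Q = sets M"
    "density M (\<lambda>z. ennreal (fn z)) = mixture \<beta> (density M (\<lambda>z. ennreal (fp z))) Q"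
proof -
  define q where "q z = (fn z - \<beta> * fp z) / (1 - \<beta>)" for z
  define Q where "Q = density M (\<lambda>z. ennreal (q z))"
  have [measurable]: "q \<in> borel_measurable M"
    unfolding q_def by measurable
  have "mixture \<beta> ?Pp Q = density M (\<lambda>z. ennreal \<beta> * ennreal (fp z) + ennreal (1 - \<beta>) * ennreal (q z))"
    unfolding Q_def by (rule mixture_density) auto
  also have "\<dots> = ?Pn"
  proof (rule density_cong)
    \<comment> \<open>On a null set \<open>q\<close> may be negative and is truncated to
      \<open>0\<close> by \<open>ennreal\<close>; elsewhere the identity holds over the
      reals.\<close>
    show "AE z in M. ennreal \<beta> * ennreal (fp z) + ennreal (1 - \<beta>) * ennreal (q z) = ennreal (fn z)"
      using ge AE_space
    proof eventually_elim
      case (elim z)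
      then have "0 \<le> q z" "\<beta> * fp z + (1 - \<beta>) * q z = fn z"
        using \<beta> by (auto simp: q_def)
      then show ?case
        using elim \<beta> fp0[of z]
        by (simp add: ennreal_mult[symmetric] ennreal_plus[symmetric] del: ennreal_plus)
    qed
  qed auto
  finally have mix: "?Pn = mixture \<beta> ?Pp Q" ..
  have "ennreal \<beta> + ennreal (1 - \<beta>) * emeasure Q (space M) = 1"
  proof -
    have "emeasure (mixture \<beta> ?Pp Q) (space M) =
        ennreal \<beta> * emeasure ?Pp (space M) + ennreal (1 - \<beta>) * emeasure Q (space M)"
      by (rule emeasure_mixture) (auto simp: Q_def)
    then show ?thesis
      using prob_space.emeasure_space_1[OF Pp] prob_space.emeasure_space_1[OF Pn]
      by (simp add: mix[symmetric])
  qed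
  \<comment> \<open>Infinite mass is impossible since its coefficient \<open>1 - \<beta>\<close> is
    positive, so the equation can be solved over the reals.\<close>
  then obtain r where r: "emeasure Q (space M) = ennreal r" "\<beta> + (1 - \<beta>) * r = 1"
    using \<beta> by (cases "emeasure Q (space M)")
      (auto simp: ennreal_mult[symmetric] ennreal_plus[symmetric] ennreal_mult_top
        simp del: ennreal_plus)
  then have "(1 - \<beta>) * r = 1 - \<beta>"
    by linarith
  then have "emeasure Q (space M) = 1"
    using r(1) \<beta>(2) by simp
  then have "prob_space Q"
    by (intro prob_spaceI) (simp add: Q_def)
  then show thesis
    using mix by (intro that[of Q]) (auto simp: Q_def)
qed

text \<open>Only the existence of a positive constant matters, so either direction may shrink it: it
  is halved from left to right and capped from right to left.\<close>

lemma not_irreducible_wrt_density_iff: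
  fixes fp fn :: "'o \<Rightarrow> real"
  assumes "fp \<in> borel_measurable M" "fn \<in> borel_measurable M"
    and fp0: "\<And>z. z \<in> space M \<Longrightarrow> 0 \<le> fp z" and fn0: "\<And>z. z \<in> space M \<Longrightarrow> 0 \<le> fn z"
    and "prob_space (density M (\<lambda>z. ennreal (fp z)))" (is "prob_space ?Pp")
    and "prob_space (density M (\<lambda>z. ennreal (fn z)))" (is "prob_space ?Pn")
  shows "\<not> irreducible_wrt (density M (\<lambda>z. ennreal (fn z))) (density M (\<lambda>z. ennreal (fp z))) \<longleftrightarrow>
    (\<exists>\<beta>>0. AE z in M. \<beta> * fp z \<le> fn z)"
proof
  assume "\<not> irreducible_wrt ?Pn ?Pp"
  then obtain Q \<beta> where "sets Q = sets M" "0 < \<beta>" "?Pn = mixture \<beta> ?Pp Q"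
    by (auto simp: irreducible_wrt_def)
  with assms have "AE z in M. \<beta> / 2 * fp z \<le> fn z"
    by (intro AE_ge_of_mixture)
  then show "\<exists>\<beta>>0. AE z in M. \<beta> * fp z \<le> fn z"
    using \<open>0 < \<beta>\<close> by (intro exI[of _ "\<beta> / 2"]) simp
next
  assume "\<exists>\<beta>>0. AE z in M. \<beta> * fp z \<le> fn z"
  then obtain \<beta> where \<beta>: "0 < \<beta>" "AE z in M. \<beta> * fp z \<le> fn z"
    by blast
  \<comment> \<open>The cap keeps the remainder's weight \<open>1 - \<beta>'\<close> positive;
    lowering the constant preserves the bound because \<open>fp\<close> is nonnegative.\<close>
  define \<beta>' where "\<beta>' = min \<beta> (1 / 2)"
  have \<beta>': "0 < \<beta>'" "\<beta>' < 1" "\<beta>' \<le> \<beta>"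
    using \<beta>(1) by (auto simp: \<beta>'_def)
  have "AE z in M. \<beta>' * fp z \<le> fn z"
    using \<beta>(2) AE_space
  proof eventually_elim
    case (elim z)
    then show ?case
      using mult_right_mono[OF \<beta>'(3) fp0[of z]] by simp
  qed
  then obtain Q where "prob_space Q" "sets Q = sets M" "?Pn = mixture \<beta>' ?Pp Q"
    using mixture_of_AE_ge[of fp M fn \<beta>'] assms \<beta>' by blast
  then show "\<not> irreducible_wrt ?Pn ?Pp"
    using \<beta>' by (auto simp: irreducible_wrt_def intro!: exI[of _ Q] exI[of _ \<beta>'])
qed

section \<open>The posterior and its essential supremum\<close>

lemma posterior_le_one:
  assumes "0 < \<pi>p" "\<pi>p < 1" "0 \<le> fn z"
  shows "posterior \<pi>p fp fn z \<le> 1"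
  using assms by (auto simp: posterior_def marginal_density_def)

text \<open>Clearing the denominator makes the bound linear. The linear form also covers zero
  marginal density: both densities vanish there, and the default posterior \<open>0\<close> is below
  \<open>c\<close>.\<close>

lemma posterior_le_iff:
  assumes "0 < \<pi>p" "\<pi>p < 1" "0 \<le> fp z" "0 \<le> fn z" "0 < c"
  shows "posterior \<pi>p fp fn z \<le> c \<longleftrightarrow> (1 - c) * \<pi>p * fp z \<le> c * (1 - \<pi>p) * fn z"
proof (cases "marginal_density \<pi>p fp fn z > 0")
  case True
  then have "posterior \<pi>p fp fn z \<le> c \<longleftrightarrow> \<pi>p * fp z \<le> c * marginal_density \<pi>p fp fn z"
    by (simp add: posterior_def pos_divide_le_eq)
  then show ?thesis
    by (simp add: marginal_density_def algebra_simps)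
next
  case False
  moreover have "0 \<le> \<pi>p * fp z" "0 \<le> (1 - \<pi>p) * fn z"
    using assms by auto
  ultimately have "\<pi>p * fp z = 0" "(1 - \<pi>p) * fn z = 0"
    unfolding marginal_density_def by linarith+
  with False assms show ?thesis
    by (simp add: posterior_def)
qed

lemma measurable_posterior [measurable]:
  assumes [measurable]: "fp \<in> borel_measurable M" "fn \<in> borel_measurable M"
  shows "posterior \<pi>p fp fn \<in> borel_measurable M"
  unfolding posterior_def[abs_def] marginal_density_def by measurable

text \<open>The essential supremum lives under the marginal, the ratio bound under \<open>M\<close>.
  The two differ only where the marginal density is not positive, and there the posterior is
  \<open>0\<close>, which never exceeds \<open>c\<close>.\<close>

lemma AE_marginal_posterior_le_iff:
  assumes [measurable]: "fp \<in> borel_measurable M" "fn \<in> borel_measurable M" and "0 \<le> c"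
  shows "(AE z in density M (\<lambda>z. ennreal (marginal_density \<pi>p fp fn z)). posterior \<pi>p fp fn z \<le> c)
    \<longleftrightarrow> (AE z in M. posterior \<pi>p fp fn z \<le> c)"
proof -
  have [measurable]: "marginal_density \<pi>p fp fn \<in> borel_measurable M"
    unfolding marginal_density_def[abs_def] by measurable
  have "(0 < marginal_density \<pi>p fp fn z \<longrightarrow> posterior \<pi>p fp fn z \<le> c) \<longleftrightarrow>
      posterior \<pi>p fp fn z \<le> c" for z
    using \<open>0 \<le> c\<close> by (auto simp: posterior_def)
  then show ?thesis
    by (subst AE_density) auto
qed

text \<open>A strict inequality leaves room for a real bound \<open>c < 1\<close>, and such a
  \<open>c\<close> corresponds to a ratio bound \<open>\<beta>\<close> through
  \<open>posterior_le_iff\<close>.\<close>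

lemma esssup_posterior_less_one_iff:
  assumes \<pi>p: "0 < \<pi>p" "\<pi>p < 1"
    and [measurable]: "fp \<in> borel_measurable M" "fn \<in> borel_measurable M"
    and fp0: "\<And>z. z \<in> space M \<Longrightarrow> 0 \<le> fp z" and fn0: "\<And>z. z \<in> space M \<Longrightarrow> 0 \<le> fn z"
  shows "esssup (density M (\<lambda>z. ennreal (marginal_density \<pi>p fp fn z)))
      (\<lambda>z. ereal (posterior \<pi>p fp fn z)) < 1 \<longleftrightarrow> (\<exists>\<beta>>0. AE z in M. \<beta> * fp z \<le> fn z)"
    (is "esssup ?P ?f < 1 \<longleftrightarrow> _")
proof
  assume "esssup ?P ?f < 1"
  \<comment> \<open>The maximum with \<open>0\<close> makes the intermediate \<open>c\<close>
    positive, so that one can divide by it.\<close>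
  then have "max 0 (esssup ?P ?f) < 1"
    by simp
  then obtain c where "max 0 (esssup ?P ?f) < ereal c" "ereal c < 1"
    using ereal_dense2 by blast
  then have c: "0 < c" "c < 1" "esssup ?P ?f < ereal c"
    by auto
  have "AE z in ?P. posterior \<pi>p fp fn z \<le> c"
    using esssup_AE[of ?f ?P]
  proof eventually_elim
    case (elim z)
    then have "ereal (posterior \<pi>p fp fn z) \<le> ereal c"
      using c(3) by order
    then show ?case by simp
  qed
  then have "AE z in M. posterior \<pi>p fp fn z \<le> c"
    using c(1) by (simp add: AE_marginal_posterior_le_iff)
  \<comment> \<open>The constant comes from solving the linear form of the bound for
    \<open>fn z\<close>.\<close>
  then have "AE z in M. (1 - c) * \<pi>p / (c * (1 - \<pi>p)) * fp z \<le> fn z"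
    using AE_space
  proof eventually_elim
    case (elim z)
    then show ?case
      using posterior_le_iff[of \<pi>p fp z fn c] fp0[of z] fn0[of z] c \<pi>p
      by (simp add: pos_divide_le_eq mult_ac)
  qed
  then show "\<exists>\<beta>>0. AE z in M. \<beta> * fp z \<le> fn z"
    using c \<pi>p by (intro exI[of _ "(1 - c) * \<pi>p / (c * (1 - \<pi>p))"]) simp
next
  assume "\<exists>\<beta>>0. AE z in M. \<beta> * fp z \<le> fn z"
  then obtain \<beta> where \<beta>: "0 < \<beta>" "AE z in M. \<beta> * fp z \<le> fn z"
    by blast
  \<comment> \<open>\<open>c\<close> is the value of the posterior at a point with
    \<open>fn z = \<beta> * fp z\<close> and \<open>fp z\<close> positive.\<close>
  define d where "d = \<pi>p + (1 - \<pi>p) * \<beta>"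
  define c where "c = \<pi>p / d"
  have d: "\<pi>p < d"
    using \<beta>(1) \<pi>p by (simp add: d_def)
  then have c: "0 < c" "c < 1"
    using \<pi>p by (auto simp: c_def)
  \<comment> \<open>Both sides equal \<open>\<pi>p * (d - \<pi>p) / d\<close>.\<close>
  have c_eq: "(1 - c) * \<pi>p = c * (1 - \<pi>p) * \<beta>"
    using d \<pi>p by (simp add: c_def field_simps) (simp add: d_def algebra_simps)
  have "AE z in M. posterior \<pi>p fp fn z \<le> c"
    using \<beta>(2) AE_space
  proof eventually_elim
    case (elim z)
    then have "c * (1 - \<pi>p) * (\<beta> * fp z) \<le> c * (1 - \<pi>p) * fn z"
      using c \<pi>p by (intro mult_left_mono) auto
    then have "(1 - c) * \<pi>p * fp z \<le> c * (1 - \<pi>p) * fn z"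
      by (simp add: c_eq mult.assoc)
    then show ?case
      using posterior_le_iff[of \<pi>p fp z fn c] elim fp0[of z] fn0[of z] c \<pi>p by blast
  qed
  then have "AE z in ?P. posterior \<pi>p fp fn z \<le> c"
    using c by (simp add: AE_marginal_posterior_le_iff)
  then have "esssup ?P ?f \<le> ereal c"
    by (intro esssup_I) auto
  also have "\<dots> < 1"
    using c by simp
  finally show "esssup ?P ?f < 1" .
qed

theorem theorem2p1:
  fixes M Pp Pn P :: "('d::finite, 'g) observation measure"
    and fp fn :: "('d, 'g) observation \<Rightarrow> real"
    and \<pi>p :: real
  assumes "0 < \<pi>p" and "\<pi>p < 1"
    and "fp \<in> borel_measurable M" and "\<And>z. z \<in> space M \<Longrightarrow> 0 \<le> fp z"
    and "fn \<in> borel_measurable M" and "\<And>z. z \<in> space M \<Longrightarrow> 0 \<le> fn z"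
    and "Pp = density M (\<lambda>z. ennreal (fp z))" and "prob_space Pp"
    and "Pn = density M (\<lambda>z. ennreal (fn z))" and "prob_space Pn"
    and "P = mixture \<pi>p Pp Pn"
  shows "irreducible_wrt Pn Pp \<longleftrightarrow> esssup P (\<lambda>z. ereal (posterior \<pi>p fp fn z)) = 1"
proof -
  have [measurable]: "fp \<in> borel_measurable M" "fn \<in> borel_measurable M"
    by fact+
  have "P = density M (\<lambda>z. ennreal \<pi>p * ennreal (fp z) + ennreal (1 - \<pi>p) * ennreal (fn z))"
    unfolding assms(7,9,11) by (rule mixture_density) auto
  also have "\<dots> = density M (\<lambda>z. ennreal (marginal_density \<pi>p fp fn z))"
    using assms(1,2,4,6)
    by (intro density_cong AE_I2) (auto simp: marginal_density_def ennreal_mult)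
  finally have P: "P = density M (\<lambda>z. ennreal (marginal_density \<pi>p fp fn z))" .
  \<comment> \<open>Since \<open>1\<close> is always an upper bound, failing to equal
    \<open>1\<close> means being strictly below it, which matches the negation of
    irreducibility.\<close>
  have "esssup P (\<lambda>z. ereal (posterior \<pi>p fp fn z)) \<le> 1"
    using assms(1,2,6) unfolding P
    by (intro esssup_I AE_I2) (auto simp: posterior_le_one)
  moreover have "esssup P (\<lambda>z. ereal (posterior \<pi>p fp fn z)) < 1 \<longleftrightarrow>
      (\<exists>\<beta>>0. AE z in M. \<beta> * fp z \<le> fn z)"
    unfolding P using assms(1-6) by (intro esssup_posterior_less_one_iff)
  moreover have "\<not> irreducible_wrt Pn Pp \<longleftrightarrow> (\<exists>\<beta>>0. AE z in M. \<beta> * fp z \<le> fn z)"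
    using assms(8,10) unfolding assms(7,9)
    by (intro not_irreducible_wrt_density_iff assms(3-6))
  ultimately show ?thesis
    by (auto simp: less_le)
qed

end
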